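(* Let $m,n>p\geq 1$ be integers, let $\epsilon=(\epsilon_1,\ldots,\epsilon_p)\in\{1,-1\}^p$ be any sign pattern, and let $A\in\mathbb{R}^{m\times n}$ be an SSR$_p(\epsilon)$ matrix. Then between any two consecutive columns (respectively, any two consecutive rows) of $A$ one can insert a column in $\mathbb{R}^m$ (respectively, a row in $\mathbb{R}^n$), leaving the entries of $A$ unchanged, such that the resulting $m\times(n+1)$ (respectively, $(m+1)\times n$) matrix is SSR$_p(\epsilon)$.
   Context: All matrices are real. For integers $m,n\geq p\geq 1$ and $\epsilon=(\epsilon_1,\ldots,\epsilon_p)\in\{1,-1\}^p$, an $m\times n$ matrix is strictly sign regular of order $p$ with sign pattern $\epsilon$, written SSR$_p(\epsilon)$, if for every $1\leq k\leq p$ all its $k\times k$ minors are non-zero and have sign $\epsilon_k$. Here the $k\times k$ minors are the determinants of the submatrices with rows $I$ and columns $J$, $|I|=|J|=k$, rows and columns kept in increasing order. *)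

theory Defs
  imports
    Complex_Main
    "Jordan_Normal_Form.Determinant"
    "Jordan_Normal_Form.DL_Submatrix"
begin

text \<open>Rows and columns of a matrix are numbered from 0. The constant \<^const>\<open>submatrix\<close> keeps the
  selected rows and columns in increasing order. The entry of the sign pattern belonging to minors
  of size \<open>k\<close> is \<open>\<epsilon> k\<close>, for \<open>1 \<le> k \<le> p\<close>; other values of \<open>\<epsilon>\<close> are irrelevant.
  The notion is meant for \<open>p \<le> dim_row A\<close> and \<open>p \<le> dim_col A\<close>; there are no minors of larger size.\<close>

definition is_sign_pattern :: "nat \<Rightarrow> (nat \<Rightarrow> real) \<Rightarrow> bool" where
  "is_sign_pattern p \<epsilon> \<longleftrightarrow> (\<forall>k\<in>{1..p}. \<epsilon> k \<in> {1, -1})"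

definition SSR :: "nat \<Rightarrow> (nat \<Rightarrow> real) \<Rightarrow> real mat \<Rightarrow> bool" where
  "SSR p \<epsilon> A \<longleftrightarrow>
     (\<forall>k\<in>{1..p}. \<forall>I J. I \<subseteq> {..<dim_row A} \<and> J \<subseteq> {..<dim_col A} \<and> card I = k \<and> card J = k \<longrightarrow>
        det (submatrix A I J) \<noteq> 0 \<and> sgn (det (submatrix A I J)) = \<epsilon> k)"

text \<open>The inserted column (row) gets index \<open>j\<close> (\<open>i\<close>) in the new matrix, so it stands between the
  original columns (rows) \<open>j - 1\<close> and \<open>j\<close> (\<open>i - 1\<close> and \<open>i\<close>).\<close>

definition insert_col :: "'a mat \<Rightarrow> nat \<Rightarrow> 'a vec \<Rightarrow> 'a mat" where
  "insert_col A j v = mat (dim_row A) (dim_col A + 1)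
     (\<lambda>(r, c). if c < j then A $$ (r, c) else if c = j then v $ r else A $$ (r, c - 1))"

definition insert_row :: "'a mat \<Rightarrow> nat \<Rightarrow> 'a vec \<Rightarrow> 'a mat" where
  "insert_row A i v = mat (dim_row A + 1) (dim_col A)
     (\<lambda>(r, c). if r < i then A $$ (r, c) else if r = i then v $ c else A $$ (r - 1, c))"

end

theory Submission
  imports Defs
begin

text \<open>Let \<open>c\<^sub>0, \<dots>, c\<^bsub>n-1\<^esub>\<close> be the columns and let the new column \<open>v\<close> get index \<open>j\<close>. List the columns as
  \<open>c\<^sub>j, c\<^bsub>j+1\<^esub>, \<dots>, c\<^bsub>n-1\<^esub>, c\<^bsub>j-1\<^esub>, \<dots>, c\<^sub>0\<close>, so that on either side of the gap those nearer to it come first,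
  and let \<open>v\<close> be their combination with the powers \<open>1, \<delta>, \<delta>\<^sup>2, \<dots>\<close> of a small \<open>\<delta> > 0\<close> as weights and with signs
  that alternate on either side, starting with \<open>+\<close> next to the gap. Expand a minor on \<open>v\<close> and old columns \<open>S\<close>
  by linearity. The columns in \<open>S\<close> contribute nothing, so the leading term belongs to the first column \<open>l\<close> of
  the list outside \<open>S\<close>. All columns between \<open>l\<close> and the gap lie in \<open>S\<close>; moving \<open>l\<close> across them to its place
  produces exactly the sign of its weight, and what is left is the minor of \<open>A\<close> on \<open>S \<union> {l}\<close>. There are finitely
  many minors, so one \<open>\<delta>\<close> serves them all. Rows follow by transposition.\<close>

section \<open>Ranks in finite sets of indices\<close>

lemma pick_eqI:
  assumes "x \<in> S" "card {a \<in> S. a < x} = i"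
  shows "pick S i = x"
  using pick_card_in_set[OF assms(1)] assms(2) by simp

text \<open>An element is located by its rank, the number of smaller members; adding
  \<open>l\<close> raises by one the rank of exactly the elements above \<open>l\<close>.\<close>

lemma pick_insert:
  assumes "finite S" "l \<notin> S" "c \<le> card S" and q: "q = card {s \<in> S. s < l}"
  shows "pick (insert l S) c = (if c < q then pick S c else if c = q then l else pick S (c - 1))"
proof -
  consider "c < q" | "c = q" | "q < c" by linarith
  then show ?thesis
  proof cases
    case 1
    have "q \<le> card S" unfolding q by (rule card_mono) (use assms in auto)
    then have c: "c < card S" using 1 by simp
    \<comment> \<open>Otherwise all \<open>q\<close> elements of \<open>S\<close> below
      \<open>l\<close> would lie below \<open>pick S c\<close>, which has only \<open>c < q\<close>
      smaller members.\<close>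
    have "pick S c < l"
    proof (rule ccontr)
      assume "\<not> pick S c < l"
      then have "q \<le> card {a \<in> S. a < pick S c}"
        unfolding q by (intro card_mono) (use assms in auto)
      then show False using card_pick_le[OF c] 1 by simp
    qed
    then have "{a \<in> insert l S. a < pick S c} = {a \<in> S. a < pick S c}" by auto
    then have "pick (insert l S) c = pick S c"
      using pick_in_set_le[OF c] card_pick_le[OF c] by (intro pick_eqI) auto
    then show ?thesis using 1 by simp
  next
    case 2
    have "{a \<in> insert l S. a < l} = {a \<in> S. a < l}" by auto
    then have "pick (insert l S) c = l" using 2 q by (intro pick_eqI) auto
    then show ?thesis using 2 by simp
  next
    case 3
    let ?x = "pick S (c - 1)"
    have c: "c - 1 < card S" using assms(3) 3 by simp
    have "l < ?x"
    proof (rule ccontr)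
      assume "\<not> l < ?x"
      then have "?x < l" using pick_in_set_le[OF c] assms(2) by (metis linorder_neqE_nat)
      then have "card (insert ?x {a \<in> S. a < ?x}) \<le> q"
        unfolding q using pick_in_set_le[OF c] by (intro card_mono) (use assms in auto)
      then show False using card_pick_le[OF c] 3 assms(1) by simp
    qed
    then have "{a \<in> insert l S. a < ?x} = insert l {a \<in> S. a < ?x}" by auto
    then have "card {a \<in> insert l S. a < ?x} = c"
      using card_pick_le[OF c] 3 assms(1,2) by simp
    then have "pick (insert l S) c = ?x"
      using pick_in_set_le[OF c] by (intro pick_eqI) auto
    then show ?thesis using 3 by simp
  qed
qed

lemma pick_image:
  fixes f :: "nat \<Rightarrow> nat"
  assumes "strict_mono f" "c < card S"
  shows "pick (f ` S) c = f (pick S c)"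
proof (rule pick_eqI)
  show "f (pick S c) \<in> f ` S" using pick_in_set_le[OF assms(2)] by simp
  have "{a \<in> f ` S. a < f (pick S c)} = f ` {a \<in> S. a < pick S c}"
    using assms(1) by (auto simp: strict_mono_less)
  then show "card {a \<in> f ` S. a < f (pick S c)} = c"
    using card_pick_le[OF assms(2)] card_image[OF inj_on_subset[OF strict_mono_imp_inj_on[OF assms(1)] subset_UNIV]]
    by simp
qed

section \<open>Submatrices and transposition\<close>

lemma submatrix_dims:
  assumes "I \<subseteq> {..<dim_row A}" "J \<subseteq> {..<dim_col A}"
  shows "dim_row (submatrix A I J) = card I" "dim_col (submatrix A I J) = card J"
proof -
  have "{i. i < dim_row A \<and> i \<in> I} = I" "{j. j < dim_col A \<and> j \<in> J} = J"
    using assms by auto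
  then show "dim_row (submatrix A I J) = card I" "dim_col (submatrix A I J) = card J"
    by (simp_all add: dim_submatrix)
qed

lemma submatrix_entry:
  assumes "I \<subseteq> {..<dim_row A}" "J \<subseteq> {..<dim_col A}" "i < card I" "j < card J"
  shows "submatrix A I J $$ (i, j) = A $$ (pick I i, pick J j)"
  by (rule submatrix_index) (use submatrix_dims[OF assms(1,2)] assms(3,4) in \<open>simp_all add: dim_submatrix\<close>)

lemma transpose_submatrix:
  assumes "I \<subseteq> {..<dim_row A}" "J \<subseteq> {..<dim_col A}"
  shows "(submatrix A I J)\<^sup>T = submatrix A\<^sup>T J I"
proof (rule eq_matI)
  have *: "dim_row (submatrix A\<^sup>T J I) = card J" "dim_col (submatrix A\<^sup>T J I) = card I"
    using assms by (simp_all add: submatrix_dims)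
  then show "dim_row (submatrix A I J)\<^sup>T = dim_row (submatrix A\<^sup>T J I)"
    "dim_col (submatrix A I J)\<^sup>T = dim_col (submatrix A\<^sup>T J I)"
    using submatrix_dims[OF assms] by simp_all
  fix i j assume "i < dim_row (submatrix A\<^sup>T J I)" "j < dim_col (submatrix A\<^sup>T J I)"
  then have ij: "i < card J" "j < card I" using * by simp_all
  have "pick J i < dim_col A" "pick I j < dim_row A"
    using pick_in_set_le[OF ij(1)] pick_in_set_le[OF ij(2)] assms by auto
  then show "(submatrix A I J)\<^sup>T $$ (i, j) = submatrix A\<^sup>T J I $$ (i, j)"
    using ij assms submatrix_dims[OF assms] by (simp add: submatrix_entry)
qed

lemma SSR_transpose:
  assumes "SSR p \<epsilon> A"
  shows "SSR p \<epsilon> A\<^sup>T"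
  unfolding SSR_def
proof (intro ballI allI impI, elim conjE)
  fix k I J
  assume k: "k \<in> {1..p}" and I: "I \<subseteq> {..<dim_row A\<^sup>T}" and J: "J \<subseteq> {..<dim_col A\<^sup>T}"
    and c: "card I = k" "card J = k"
  have "submatrix A J I \<in> carrier_mat k k"
    using I J c by (intro carrier_matI) (auto simp: submatrix_dims)
  then have "det (submatrix A\<^sup>T I J) = det (submatrix A J I)"
    using transpose_submatrix[of J A I] I J by (metis det_transpose index_transpose_mat(2,3))
  then show "det (submatrix A\<^sup>T I J) \<noteq> 0 \<and> sgn (det (submatrix A\<^sup>T I J)) = \<epsilon> k"
    using assms k I J c unfolding SSR_def by auto
qed

lemma insert_row_transpose:
  assumes "v \<in> carrier_vec (dim_col A)" "i \<le> dim_row A"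
  shows "insert_row A i v = (insert_col A\<^sup>T i v)\<^sup>T"
  using assms by (intro eq_matI) (auto simp: insert_row_def insert_col_def)

section \<open>Inserted columns in submatrices and determinants\<close>

definition subvec :: "'a vec \<Rightarrow> nat set \<Rightarrow> 'a vec" where
  "subvec v I = vec (card I) (\<lambda>i. v $ pick I i)"

lemma insert_col_dims [simp]:
  "dim_row (insert_col A j v) = dim_row A" "dim_col (insert_col A j v) = Suc (dim_col A)"
  by (simp_all add: insert_col_def)

text \<open>Serves twice: for the minors of \<open>A\<close> that appear as leading terms, and for
  the minors of the enlarged matrix through its new column.\<close>

lemma submatrix_insert_index:
  assumes I: "I \<subseteq> {..<dim_row A}" and S: "S \<subseteq> {..<dim_col A}"
    and l: "l < dim_col A" "l \<notin> S"
  shows "submatrix A I (insert l S) =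
    insert_col (submatrix A I S) (card {s \<in> S. s < l}) (subvec (col A l) I)"
proof (rule eq_matI)
  have S': "insert l S \<subseteq> {..<dim_col A}" using S l by auto
  have fin: "finite S" using S finite_subset by blast
  note d = submatrix_dims[OF I S'] submatrix_dims[OF I S]
  show "dim_row (submatrix A I (insert l S)) =
      dim_row (insert_col (submatrix A I S) (card {s \<in> S. s < l}) (subvec (col A l) I))"
    "dim_col (submatrix A I (insert l S)) =
      dim_col (insert_col (submatrix A I S) (card {s \<in> S. s < l}) (subvec (col A l) I))"
    using d fin l by simp_all
  fix i c
  assume "i < dim_row (insert_col (submatrix A I S) (card {s \<in> S. s < l}) (subvec (col A l) I))"
    "c < dim_col (insert_col (submatrix A I S) (card {s \<in> S. s < l}) (subvec (col A l) I))"
  then have i: "i < card I" and c: "c \<le> card S" using d by simp_all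
  have q: "card {s \<in> S. s < l} \<le> card S" by (rule card_mono) (use fin in auto)
  have "pick I i < dim_row A" using pick_in_set_le[OF i] I by auto
  then show "submatrix A I (insert l S) $$ (i, c) =
      insert_col (submatrix A I S) (card {s \<in> S. s < l}) (subvec (col A l) I) $$ (i, c)"
    using i c q fin l d
    by (auto simp: submatrix_entry[OF I S'] submatrix_entry[OF I S] insert_col_def subvec_def
        pick_insert[OF fin l(2) c refl])
qed

text \<open>The index that old column \<open>c\<close> receives once a column has been inserted at
  \<open>j\<close>; the range misses exactly \<open>j\<close>.\<close>

definition skip :: "nat \<Rightarrow> nat \<Rightarrow> nat" where
  "skip j c = (if c < j then c else Suc c)"

lemma strict_mono_skip: "strict_mono (skip j)"
  by (auto simp: strict_mono_def skip_def)

lemma skip_vimage: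
  assumes "j \<notin> J"
  shows "skip j ` (skip j -` J) = J"
proof -
  have "x \<in> range (skip j)" if "x \<in> J" for x
  proof (cases "x < j")
    case True
    then have "x = skip j x" by (simp add: skip_def)
    then show ?thesis by blast
  next
    case False
    then have "x = skip j (x - 1)" using assms that by (cases "x = j") (auto simp: skip_def)
    then show ?thesis by blast
  qed
  then show ?thesis by auto
qed

text \<open>Minors that avoid the new column are therefore minors of \<open>A\<close>, and the
  choice of \<open>v\<close> cannot affect them.\<close>

lemma submatrix_insert_col_skip:
  assumes I: "I \<subseteq> {..<dim_row A}" and S: "S \<subseteq> {..<dim_col A}"
  shows "submatrix (insert_col A j v) I (skip j ` S) = submatrix A I S"
proof (rule eq_matI)
  have I': "I \<subseteq> {..<dim_row (insert_col A j v)}" using I by simp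
  have S': "skip j ` S \<subseteq> {..<dim_col (insert_col A j v)}"
    using S by (auto simp: skip_def)
  have "card (skip j ` S) = card S"
    by (rule card_image, rule inj_on_subset[OF strict_mono_imp_inj_on[OF strict_mono_skip] subset_UNIV])
  note d = submatrix_dims[OF I' S'] submatrix_dims[OF I S] this
  show "dim_row (submatrix (insert_col A j v) I (skip j ` S)) = dim_row (submatrix A I S)"
    "dim_col (submatrix (insert_col A j v) I (skip j ` S)) = dim_col (submatrix A I S)"
    using d by simp_all
  fix i c assume "i < dim_row (submatrix A I S)" "c < dim_col (submatrix A I S)"
  then have i: "i < card I" and c: "c < card S" using d by simp_all
  have "pick I i < dim_row A" "pick S c < dim_col A"
    using pick_in_set_le[OF i] pick_in_set_le[OF c] I S by auto
  then have "insert_col A j v $$ (pick I i, skip j (pick S c)) = A $$ (pick I i, pick S c)"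
    by (auto simp: insert_col_def skip_def)
  then show "submatrix (insert_col A j v) I (skip j ` S) $$ (i, c) = submatrix A I S $$ (i, c)"
    using i c d by (simp add: submatrix_entry[OF I' S'] submatrix_entry[OF I S]
        pick_image[OF strict_mono_skip])
qed

text \<open>The cofactors along the inserted column do not involve that column, and its position enters only
  through a sign; hence the cofactors of the matrix with a zero column in front.\<close>
lemma det_insert_col:
  fixes B :: "'a :: comm_ring_1 mat"
  assumes B: "B \<in> carrier_mat (Suc t) t" and q: "q \<le> t"
  shows "det (insert_col B q w) =
    (-1) ^ q * (\<Sum>i<Suc t. w $ i * cofactor (insert_col B 0 (0\<^sub>v (Suc t))) i 0)"
proof -
  let ?M = "insert_col B q w" and ?N = "insert_col B 0 (0\<^sub>v (Suc t))"
  have cof: "cofactor ?M i q = (-1) ^ q * cofactor ?N i 0" if "i < Suc t" for i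
  proof -
    have "mat_delete ?M i q = mat_delete ?N i 0"
      using B q that by (intro eq_matI) (auto simp: mat_delete_def insert_col_def)
    then show ?thesis by (simp add: cofactor_def power_add)
  qed
  have "det ?M = (\<Sum>i<Suc t. ?M $$ (i, q) * cofactor ?M i q)"
    by (rule laplace_expansion_column) (use B q in \<open>auto simp: insert_col_def\<close>)
  also have "\<dots> = (\<Sum>i<Suc t. (-1) ^ q * (w $ i * cofactor ?N i 0))"
  proof (intro sum.cong refl)
    fix i assume "i \<in> {..<Suc t}"
    then have "?M $$ (i, q) = w $ i" "i < Suc t" using B q by (auto simp: insert_col_def)
    then show "?M $$ (i, q) * cofactor ?M i q = (-1) ^ q * (w $ i * cofactor ?N i 0)"
      by (simp only: cof mult.left_commute)
  qed
  finally show ?thesis by (simp only: sum_distrib_left)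
qed

text \<open>This removes the columns already present in a minor from its expansion. Position 0
  suffices, since other positions only change the sign.\<close>

lemma det_insert_col_duplicate:
  fixes B :: "'a :: comm_ring_1 mat"
  assumes B: "B \<in> carrier_mat (Suc t) t" and c: "c < t"
  shows "det (insert_col B 0 (col B c)) = 0"
proof (rule det_identical_columns)
  show "insert_col B 0 (col B c) \<in> carrier_mat (Suc t) (Suc t)" using B by auto
  show "0 \<noteq> Suc c" "0 < Suc t" "Suc c < Suc t" using c by auto
  show "col (insert_col B 0 (col B c)) 0 = col (insert_col B 0 (col B c)) (Suc c)"
    using B c by (intro eq_vecI) (auto simp: insert_col_def)
qed

section \<open>Leading terms for small weights, and the new column\<close>

text \<open>Divided by \<open>\<delta> ^ r0\<close>, the sum tends to its leading coefficient
  \<open>a r0\<close> as \<open>\<delta>\<close> decreases to 0.\<close>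

lemma eventually_sum_pos:
  fixes a :: "nat \<Rightarrow> real"
  assumes "r0 < n" "\<And>r. r < r0 \<Longrightarrow> a r = 0" "a r0 > 0"
  shows "eventually (\<lambda>\<delta>. (\<Sum>r<n. a r * \<delta> ^ r) > 0) (at_right 0)"
proof -
  let ?g = "\<lambda>\<delta>::real. \<Sum>r = r0..<n. a r * \<delta> ^ (r - r0)"
  have "(?g \<longlongrightarrow> (\<Sum>r = r0..<n. a r * 0 ^ (r - r0))) (at_right 0)"
    by (intro tendsto_intros)
  \<comment> \<open>At 0 only the term \<open>r0\<close> survives, because
    \<open>0 ^ 0 = 1\<close>.\<close>
  also have "(\<Sum>r = r0..<n. a r * 0 ^ (r - r0)) = (\<Sum>r\<in>{r0}. a r)"
    using assms(1) by (intro sum.mono_neutral_cong_right) auto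
  finally have "(?g \<longlongrightarrow> a r0) (at_right 0)" by simp
  then have "eventually (\<lambda>\<delta>. ?g \<delta> > 0) (at_right 0)"
    using assms(3) by (rule order_tendstoD)
  moreover have "eventually (\<lambda>\<delta>::real. \<delta> > 0) (at_right 0)"
    by (simp add: eventually_at_right_less)
  ultimately show ?thesis
  proof eventually_elim
    case (elim \<delta>)
    have "(\<Sum>r<n. a r * \<delta> ^ r) = (\<Sum>r = r0..<n. a r * \<delta> ^ r)"
      using assms(2) by (intro sum.mono_neutral_right) auto
    also have "\<dots> = \<delta> ^ r0 * ?g \<delta>"
      unfolding sum_distrib_left
      by (intro sum.cong refl) (simp add: mult.left_commute flip: power_add)
    finally show ?case using elim by simp
  qed
qed

text \<open>First the \<open>n - j\<close> columns to the right of the gap, then the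
  \<open>j\<close> columns to its left, each time going outwards.\<close>

definition col_order :: "nat \<Rightarrow> nat \<Rightarrow> nat \<Rightarrow> nat" where
  "col_order n j r = (if r < n - j then j + r else n - 1 - r)"

text \<open>The exponent is the number of columns strictly between the gap and column
  \<open>col_order n j r\<close>.\<close>

definition col_sign :: "nat \<Rightarrow> nat \<Rightarrow> nat \<Rightarrow> real" where
  "col_sign n j r = (if r < n - j then (-1) ^ r else (-1) ^ (r - (n - j)))"

definition gap_vec :: "real mat \<Rightarrow> nat \<Rightarrow> real \<Rightarrow> real vec" where
  "gap_vec A j \<delta> = vec (dim_row A) (\<lambda>i. \<Sum>r<dim_col A.
     col_sign (dim_col A) j r * \<delta> ^ r * A $$ (i, col_order (dim_col A) j r))"

lemma col_order_less: "r < n \<Longrightarrow> col_order n j r < n"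
  by (auto simp: col_order_def)

lemma col_order_surj:
  assumes "l < n" "j \<le> n"
  shows "\<exists>r<n. col_order n j r = l"
proof (cases "j \<le> l")
  case True
  then show ?thesis using assms by (intro exI[of _ "l - j"]) (auto simp: col_order_def)
next
  case False
  then show ?thesis using assms by (intro exI[of _ "n - 1 - l"]) (auto simp: col_order_def)
qed

text \<open>By \<open>before\<close>, every column between the gap and the first missing one lies in
  \<open>S\<close>. The two cardinalities thus differ by the number of these columns, which is the
  exponent in \<open>col_sign\<close>.\<close>

lemma first_missing_sign:
  assumes j: "j \<le> n" and S: "S \<subseteq> {..<n}" and r0: "r0 < n" "col_order n j r0 \<notin> S"
    and before: "\<And>r. r < r0 \<Longrightarrow> col_order n j r \<in> S"
  shows "(-1) ^ card {s \<in> S. s < j} * col_sign n j r0 *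
    (-1) ^ card {s \<in> S. s < col_order n j r0} = (1 :: real)"
proof (cases "r0 < n - j")
  case True
  have fin: "finite S" using S finite_subset by blast
  have "x \<in> S" if "j \<le> x" "x < j + r0" for x
    using before[of "x - j"] that True by (auto simp: col_order_def split: if_splits)
  then have "{s \<in> S. s < j + r0} = {s \<in> S. s < j} \<union> {j..<j + r0}" by auto
  also have "card \<dots> = card {s \<in> S. s < j} + r0"
    using fin by (subst card_Un_disjoint) auto
  finally show ?thesis using True by (simp add: col_order_def col_sign_def minus_one_power_iff)
next
  case False
  have fin: "finite S" using S finite_subset by blast
  define l where "l = n - 1 - r0"
  have l: "col_order n j r0 = l" "l < j" "r0 - (n - j) = j - 1 - l"
    using False r0 j by (auto simp: col_order_def l_def)
  have "x \<in> S" if "l < x" "x < j" for x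
  proof -
    \<comment> \<open>Column \<open>x\<close> stands at position \<open>n - 1 - x\<close> of the
      list, before \<open>l\<close> because it is nearer to the gap.\<close>
    have "n - 1 - x < r0" "\<not> n - 1 - x < n - j" "n - 1 - (n - 1 - x) = x"
      using that r0(1) j by (auto simp: l_def)
    then show ?thesis using before[of "n - 1 - x"] by (simp add: col_order_def)
  qed
  then have "{s \<in> S. s < j} = {s \<in> S. s < l} \<union> {l<..<j}"
    using r0(2) unfolding l(1) using l(2) by (force simp: not_less order.order_iff_strict)
  also have "card \<dots> = card {s \<in> S. s < l} + (j - 1 - l)"
    using fin by (subst card_Un_disjoint) auto
  finally show ?thesis using False l by (simp add: col_sign_def minus_one_power_iff)
qed

text \<open>Treats one minor with \<open>t\<close> old columns. \<open>t < n\<close> leaves a column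
  outside \<open>S\<close>, and \<open>t < p\<close> makes \<open>ssr\<close> fix the sign of the
  minor of size \<open>t + 1\<close> that this column completes.\<close>

lemma eventually_gap_minor:
  assumes A: "A \<in> carrier_mat m n" and j: "j \<le> n" and ssr: "SSR p \<epsilon> A"
    and I: "I \<subseteq> {..<m}" "card I = Suc t" and S: "S \<subseteq> {..<n}" "card S = t" and t: "t < p" "t < n"
  shows "eventually (\<lambda>\<delta>. sgn (det (insert_col (submatrix A I S) (card {s \<in> S. s < j})
    (subvec (gap_vec A j \<delta>) I))) = \<epsilon> (Suc t)) (at_right 0)"
proof -
  let ?B = "submatrix A I S" and ?\<sigma> = "col_order n j" and ?x = "col_sign n j"
  define q where "q l = card {s \<in> S. s < l}" for l
  \<comment> \<open>The determinant with \<open>w\<close> placed in front of \<open>?B\<close>; it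
    is linear in \<open>w\<close>, and every other position only contributes a sign.\<close>
  define D where "D w = (\<Sum>i<Suc t. w $ i * cofactor (insert_col ?B 0 (0\<^sub>v (Suc t))) i 0)" for w
  have IA: "I \<subseteq> {..<dim_row A}" and SA: "S \<subseteq> {..<dim_col A}" using A I S by auto
  have fin: "finite S" using S finite_subset by blast
  have B: "?B \<in> carrier_mat (Suc t) t"
    using submatrix_dims[OF IA SA] I S by auto
  have q_le: "q l \<le> t" for l unfolding q_def S(2)[symmetric] by (rule card_mono) (use fin in auto)
  have detD: "det (insert_col ?B (q l) w) = (-1) ^ q l * D w" for l w
    unfolding D_def by (rule det_insert_col[OF B q_le])
  have D_in: "D (subvec (col A l) I) = 0" if "l \<in> S" for l
  proof -
    have ql: "q l < t"
      unfolding q_def S(2)[symmetric] by (rule psubset_card_mono) (use fin that in auto)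
    have "pick S (q l) = l" using pick_card_in_set that unfolding q_def by simp
    moreover have "pick I i < m" if "i < Suc t" for i using pick_in_set_le[of i I] that I by auto
    ultimately have "subvec (col A l) I = col ?B (q l)"
      using A S that ql submatrix_dims[OF IA SA] I
      by (intro eq_vecI) (auto simp: subvec_def submatrix_entry[OF IA SA])
    then show ?thesis
      using det_insert_col_duplicate[OF B ql] det_insert_col[OF B, of 0] by (simp add: D_def)
  qed
  have D_out: "D (subvec (col A l) I) = (-1) ^ q l * det (submatrix A I (insert l S))"
    if "l < n" "l \<notin> S" for l
    using submatrix_insert_index[OF IA SA _ that(2)] that(1) A detD[of l]
    by (simp add: q_def flip: power_mult_distrib mult.assoc)
  have "\<exists>l<n. l \<notin> S"
    using t(2) S by (metis card_lessThan card_mono fin lessThan_iff not_less subsetI)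
  then have "\<exists>r. r < n \<and> ?\<sigma> r \<notin> S" using col_order_surj[OF _ j] by metis
  define r0 where "r0 = (LEAST r. r < n \<and> ?\<sigma> r \<notin> S)"
  have r0: "r0 < n" "?\<sigma> r0 \<notin> S"
    using LeastI_ex[OF \<open>\<exists>r. r < n \<and> ?\<sigma> r \<notin> S\<close>] unfolding r0_def by auto
  have before: "?\<sigma> r \<in> S" if "r < r0" for r
    using not_less_Least[of r "\<lambda>r. r < n \<and> ?\<sigma> r \<notin> S"] that r0(1) unfolding r0_def by auto
  define d where "d = det (submatrix A I (insert (?\<sigma> r0) S))"
  have d: "d \<noteq> 0" "sgn d = \<epsilon> (Suc t)"
  proof -
    have "insert (?\<sigma> r0) S \<subseteq> {..<dim_col A}" "card (insert (?\<sigma> r0) S) = Suc t"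
      using A S r0 fin col_order_less[OF r0(1)] by auto
    then show "d \<noteq> 0" "sgn d = \<epsilon> (Suc t)"
      using ssr[unfolded SSR_def, rule_format, of "Suc t" I "insert (?\<sigma> r0) S"] IA I(2) t(1)
      unfolding d_def by simp_all
  qed
  \<comment> \<open>\<open>(-1) ^ q j\<close> carries the new column from the front to its place;
    the factor \<open>\<epsilon> (Suc t)\<close> reduces the claim about signs to
    positivity.\<close>
  define a where "a r = \<epsilon> (Suc t) * (-1) ^ q j * ?x r * D (subvec (col A (?\<sigma> r)) I)" for r
  have "a r0 = \<epsilon> (Suc t) * ((-1) ^ q j * ?x r0 * (-1) ^ q (?\<sigma> r0)) * d"
    using D_out[OF col_order_less[OF r0(1)] r0(2)] by (simp add: a_def d_def mult_ac)
  also have "\<dots> = \<epsilon> (Suc t) * d"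
    using first_missing_sign[OF j S(1) r0 before] by (simp add: q_def)
  also have "\<dots> = \<bar>d\<bar>" unfolding d(2)[symmetric] by (simp add: abs_sgn mult.commute)
  finally have "a r0 > 0" using d by simp
  moreover have "a r = 0" if "r < r0" for r using D_in[OF before[OF that]] by (simp add: a_def)
  ultimately have "eventually (\<lambda>\<delta>. (\<Sum>r<n. a r * \<delta> ^ r) > 0) (at_right 0)"
    by (intro eventually_sum_pos[OF r0(1)]) auto
  then show ?thesis
  proof eventually_elim
    case (elim \<delta>)
    let ?v = "subvec (gap_vec A j \<delta>) I"
    have entry: "?v $ i = (\<Sum>r<n. ?x r * \<delta> ^ r * subvec (col A (?\<sigma> r)) I $ i)" if "i < Suc t" for i
    proof -
      have "pick I i < m" using pick_in_set_le[of i I] that I by auto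
      then show ?thesis using A that I col_order_less[of _ n j]
        by (auto simp: subvec_def gap_vec_def intro!: sum.cong)
    qed
    have "D ?v = (\<Sum>i<Suc t. \<Sum>r<n. ?x r * \<delta> ^ r * (subvec (col A (?\<sigma> r)) I $ i
        * cofactor (insert_col ?B 0 (0\<^sub>v (Suc t))) i 0))"
      unfolding D_def by (intro sum.cong refl) (simp add: entry sum_distrib_right mult.assoc)
    also have "\<dots> = (\<Sum>r<n. ?x r * \<delta> ^ r * D (subvec (col A (?\<sigma> r)) I))"
      by (subst sum.swap) (simp only: D_def sum_distrib_left)
    finally have "\<epsilon> (Suc t) * det (insert_col ?B (q j) ?v) = (\<Sum>r<n. a r * \<delta> ^ r)"
      by (simp add: detD a_def sum_distrib_left mult_ac)
    then have "\<epsilon> (Suc t) * det (insert_col ?B (q j) ?v) > 0" using elim by simp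
    \<comment> \<open>As the sign of the nonzero \<open>d\<close>, \<open>\<epsilon> (Suc t)\<close>
      is 1 or -1, so a positive product forces the determinant to have that sign.\<close>
    then show ?case using d unfolding q_def by (auto simp: sgn_if zero_less_mult_iff split: if_splits)
  qed
qed

section \<open>One weight for all minors, and the transfer to rows\<close>

lemma ex_insert_col_SSR:
  assumes A: "A \<in> carrier_mat m n" and j: "j \<le> n" and p: "p \<le> n" and ssr: "SSR p \<epsilon> A"
  shows "\<exists>v\<in>carrier_vec m. SSR p \<epsilon> (insert_col A j v)"
proof -
  let ?P = "\<lambda>(I, S) \<delta>. sgn (det (insert_col (submatrix A I S) (card {s \<in> S. s < j})
    (subvec (gap_vec A j \<delta>) I))) = \<epsilon> (card I)"
  \<comment> \<open>\<open>S\<close> holds only the old columns of a minor, hence one index fewer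
    than \<open>I\<close>.\<close>
  let ?X = "{(I, S). I \<subseteq> {..<m} \<and> S \<subseteq> {..<n} \<and> card I = Suc (card S) \<and> card S < p}"
  have "finite ?X"
    by (rule finite_subset[of _ "Pow {..<m} \<times> Pow {..<n}"]) auto
  moreover have "\<forall>X\<in>?X. eventually (?P X) (at_right 0)"
    using eventually_gap_minor[OF A j ssr] p by auto
  ultimately have "eventually (\<lambda>\<delta>. \<forall>X\<in>?X. ?P X \<delta>) (at_right 0)"
    by (rule eventually_ball_finite)
  then obtain \<delta> where \<delta>: "\<forall>X\<in>?X. ?P X \<delta>"
    using eventually_happens' trivial_limit_at_right_real by blast
  let ?v = "gap_vec A j \<delta>"
  let ?C = "insert_col A j ?v"
  have col_C: "col ?C j = ?v" using A j by (intro eq_vecI) (auto simp: insert_col_def gap_vec_def)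
  have "SSR p \<epsilon> ?C"
    unfolding SSR_def
  proof (intro ballI allI impI, elim conjE)
    fix k I J
    assume k: "k \<in> {1..p}" and I: "I \<subseteq> {..<dim_row ?C}" "card I = k"
      and J: "J \<subseteq> {..<dim_col ?C}" "card J = k"
    \<comment> \<open>The old columns of the minor, numbered as in \<open>A\<close>.\<close>
    define S where "S = skip j -` (J - {j})"
    have JS: "skip j ` S = J - {j}" unfolding S_def by (rule skip_vimage) simp
    have cS: "card S = card (J - {j})"
      unfolding JS[symmetric]
      by (rule card_image[symmetric], rule inj_on_subset[OF strict_mono_imp_inj_on[OF strict_mono_skip] subset_UNIV])
    have SA: "S \<subseteq> {..<dim_col A}"
    proof
      fix s assume "s \<in> S"
      then have "skip j s < Suc (dim_col A)" using J by (auto simp: S_def)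
      then show "s \<in> {..<dim_col A}" using j A by (auto simp: skip_def split: if_splits)
    qed
    have IA: "I \<subseteq> {..<dim_row A}" using I by simp
    have sub: "submatrix ?C I (J - {j}) = submatrix A I S"
      using submatrix_insert_col_skip[OF IA SA, of j ?v] JS by simp
    show "det (submatrix ?C I J) \<noteq> 0 \<and> sgn (det (submatrix ?C I J)) = \<epsilon> k"
    proof (cases "j \<in> J")
      case False
      then show ?thesis using ssr k I(2) J(2) IA SA cS sub unfolding SSR_def by auto
    next
      case True
      have fin: "finite J" using J finite_subset by blast
      then have card: "card I = Suc (card S)"
        using True I J cS k card_Suc_Diff1 by metis
      \<comment> \<open>\<open>skip j\<close> fixes all indices below \<open>j\<close>, so the new
        column has the same rank in either numbering.\<close>
      have "{s \<in> J - {j}. s < j} = {s \<in> S. s < j}"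
        unfolding JS[symmetric] by (auto simp: skip_def image_iff)
      then have "submatrix ?C I J = insert_col (submatrix A I S) (card {s \<in> S. s < j}) (subvec ?v I)"
        using submatrix_insert_index[of I ?C "J - {j}" j] I J A j True sub col_C
        by (simp add: insert_absorb) blast
      moreover have "(I, S) \<in> ?X" using IA SA A card I k by auto
      ultimately have sgn: "sgn (det (submatrix ?C I J)) = \<epsilon> k" using \<delta> I by auto
      \<comment> \<open>Since \<open>sgn 0 = 0\<close>, this excludes a vanishing determinant; any
        minor of \<open>A\<close> of size \<open>k\<close> provides it, and one exists because
        \<open>k \<le> p \<le> n\<close>.\<close>
      have "\<epsilon> k \<noteq> 0"
      proof -
        have "k \<le> dim_col A" using k p A by auto
        then obtain K where "K \<subseteq> {..<dim_col A}" "card K = k"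
          using obtain_subset_with_card_n[of k "{..<dim_col A}"] by auto
        then have "\<epsilon> k = sgn (det (submatrix A I K))" "det (submatrix A I K) \<noteq> 0"
          using ssr k I IA unfolding SSR_def by auto
        then show ?thesis by (simp add: sgn_zero_iff)
      qed
      then show ?thesis using sgn by auto
    qed
  qed
  moreover have "?v \<in> carrier_vec m" using A by (auto simp: gap_vec_def)
  ultimately show ?thesis by blast
qed

theorem theorem3p2:
  fixes m n p :: nat and \<epsilon> :: "nat \<Rightarrow> real" and A :: "real mat"
  assumes "1 \<le> p" and "p < m" and "p < n"
    and "is_sign_pattern p \<epsilon>"
    and "A \<in> carrier_mat m n"
    and "SSR p \<epsilon> A"
  shows "(\<forall>j. j + 1 < n \<longrightarrow> (\<exists>v\<in>carrier_vec m. SSR p \<epsilon> (insert_col A (j + 1) v))) \<and>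
         (\<forall>i. i + 1 < m \<longrightarrow> (\<exists>w\<in>carrier_vec n. SSR p \<epsilon> (insert_row A (i + 1) w)))"
proof (intro conjI allI impI)
  fix j assume "j + 1 < n"
  then show "\<exists>v\<in>carrier_vec m. SSR p \<epsilon> (insert_col A (j + 1) v)"
    using ex_insert_col_SSR[OF assms(5)] assms by simp
next
  fix i assume i: "i + 1 < m"
  have "A\<^sup>T \<in> carrier_mat n m" using assms(5) by simp
  then obtain w where w: "w \<in> carrier_vec n" "SSR p \<epsilon> (insert_col A\<^sup>T (i + 1) w)"
    using ex_insert_col_SSR[of "A\<^sup>T" n m "i + 1" p \<epsilon>] SSR_transpose[OF assms(6)] i assms(2)
    by (metis less_imp_le)
  then have "SSR p \<epsilon> (insert_row A (i + 1) w)"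
    using SSR_transpose[OF w(2)] insert_row_transpose[of w A "i + 1"] assms(5) i by simp
  then show "\<exists>w\<in>carrier_vec n. SSR p \<epsilon> (insert_row A (i + 1) w)" using w(1) by blast
qed

end
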